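(* There exist an absolute constant $c>0$ and $\epsilon_0>0$ such that for every constant $0<\epsilon<\epsilon_0$ and all sufficiently large $n$, in the game $\mathcal{L}(n,b)$ with $b=(1-\epsilon)n$, Maker has a strategy guaranteeing that her graph contains a path of length at least $c\epsilon^2 n$.
   Context: The game $\mathcal{L}(n,b)$ is played by two players, Maker and Breaker, on the edge set of the complete graph $K_n$. Maker moves first; in each round Maker claims $1$ previously unclaimed edge and then Breaker claims $b$ previously unclaimed edges, until all edges of $K_n$ are claimed. Maker's graph is the graph on $[n]$ formed by the edges she has claimed. *)

theory Defs
  imports Complex_Main
begin

type_synonym edge = "nat set"

text \<open>A round is Maker's edge together with the set of edges Breaker claims in reply;
  a history lists the completed rounds, oldest first.\<close>
type_synonym history = "(edge \<times> edge set) list"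

definition complete_edges :: "nat \<Rightarrow> edge set" where
  "complete_edges n = {e. e \<subseteq> {1..n} \<and> card e = 2}"

definition maker_edges :: "history \<Rightarrow> edge set" where
  "maker_edges h = fst ` set h"

definition breaker_edges :: "history \<Rightarrow> edge set" where
  "breaker_edges h = \<Union> (snd ` set h)"

definition free_edges :: "nat \<Rightarrow> history \<Rightarrow> edge set" where
  "free_edges n h = complete_edges n - (maker_edges h \<union> breaker_edges h)"

text \<open>Breaker claims exactly \<open>b\<close> edges in each round, except that in the last round he
  claims all remaining edges if there are fewer than \<open>b\<close> of them.\<close>
inductive legal_history :: "nat \<Rightarrow> nat \<Rightarrow> history \<Rightarrow> bool" for n b :: nat where
  start: "legal_history n b []"
| round: "\<lbrakk>legal_history n b h; e \<in> free_edges n h; F \<subseteq> free_edges n h - {e};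
    card F = min b (card (free_edges n h - {e}))\<rbrakk> \<Longrightarrow> legal_history n b (h @ [(e, F)])"

definition finished :: "nat \<Rightarrow> history \<Rightarrow> bool" where
  "finished n h \<longleftrightarrow> free_edges n h = {}"

definition maker_strategy :: "nat \<Rightarrow> nat \<Rightarrow> (history \<Rightarrow> edge) \<Rightarrow> bool" where
  "maker_strategy n b \<sigma> \<longleftrightarrow>
     (\<forall>h. legal_history n b h \<and> \<not> finished n h \<longrightarrow> \<sigma> h \<in> free_edges n h)"

definition follows :: "(history \<Rightarrow> edge) \<Rightarrow> history \<Rightarrow> bool" where
  "follows \<sigma> h \<longleftrightarrow> (\<forall>i < length h. fst (h ! i) = \<sigma> (take i h))"

definition maker_can_guarantee :: "nat \<Rightarrow> nat \<Rightarrow> (edge set \<Rightarrow> bool) \<Rightarrow> bool" where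
  "maker_can_guarantee n b P \<longleftrightarrow>
     (\<exists>\<sigma>. maker_strategy n b \<sigma> \<and>
       (\<forall>h. legal_history n b h \<and> finished n h \<and> follows \<sigma> h \<longrightarrow> P (maker_edges h)))"

text \<open>A path is given by its nonempty sequence of distinct vertices; its length is its
  number of edges.\<close>
definition is_path :: "nat set \<Rightarrow> edge set \<Rightarrow> nat list \<Rightarrow> bool" where
  "is_path V E vs \<longleftrightarrow> vs \<noteq> [] \<and> set vs \<subseteq> V \<and> distinct vs \<and>
     (\<forall>i. Suc i < length vs \<longrightarrow> {vs ! i, vs ! Suc i} \<in> E)"

definition path_length :: "nat list \<Rightarrow> nat" where
  "path_length vs = length vs - 1"

end

theory Submission
  imports Defs
begin

text \<open>Maker performs a depth-first search, claiming a free edge from the current vertex to an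
  unvisited vertex whenever there is one. Every pair of a finished and an unvisited vertex was
  claimed by Breaker, and the number of rounds never exceeds the number of visited vertices.
  Once \<open>m \<approx> \<epsilon>n/2\<close> vertices are visited, Breaker holds at most \<open>b m\<close> edges, hence
  \<open>|S| (n - m) \<le> b m\<close> for the set \<open>S\<close> of finished vertices. Since \<open>b \<approx> (1 - \<epsilon>)n\<close>, this
  leaves about \<open>\<epsilon>\<^sup>2n/4\<close> visited vertices that are not finished; they form the DFS stack, which
  is a path.\<close>

section \<open>Histories and strategies\<close>

lemma maker_edges_simps [simp]:
  "maker_edges [] = {}"
  "maker_edges (h @ [(e, F)]) = insert e (maker_edges h)"
  by (auto simp: maker_edges_def)

lemma breaker_edges_simps [simp]:
  "breaker_edges [] = {}"
  "breaker_edges (h @ [(e, F)]) = F \<union> breaker_edges h"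
  by (auto simp: breaker_edges_def)

lemma follows_snoc:
  "follows \<sigma> (h @ [(e, F)]) \<longleftrightarrow> follows \<sigma> h \<and> e = \<sigma> h"
proof -
  have "follows \<sigma> (h @ [(e, F)]) \<longleftrightarrow>
      e = \<sigma> h \<and> (\<forall>i<length h. fst ((h @ [(e, F)]) ! i) = \<sigma> (take i (h @ [(e, F)])))"
    unfolding follows_def by (simp add: All_less_Suc)
  then show ?thesis
    unfolding follows_def by (auto simp: nth_append)
qed

lemma finite_free_edges: "finite (free_edges n h)"
  by (rule finite_subset[of _ "Pow {1..n}"]) (auto simp: free_edges_def complete_edges_def)

lemma breaker_edges_card:
  assumes "legal_history n b h"
  shows "finite (breaker_edges h) \<and> card (breaker_edges h) \<le> b * length h"
  using assms
proof induction
  case start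
  then show ?case by simp
next
  case (round h e F)
  have "finite F"
    using round.hyps(3) finite_free_edges finite_subset by blast
  moreover have "card (F \<union> breaker_edges h) \<le> card F + card (breaker_edges h)"
    by (rule card_Un_le)
  moreover have "card F \<le> b"
    using round.hyps(4) by simp
  ultimately show ?case
    using round.IH by auto
qed

text \<open>Reduces strategies to one-step reasoning: Maker always picks, by choice, a free edge
  after which \<open>Inv\<close> survives any reply of Breaker.\<close>

lemma maker_can_guarantee_by_invariant:
  assumes init: "Inv []"
    and step: "\<And>h. \<lbrakk>legal_history n b h; \<not> finished n h; Inv h\<rbrakk>
      \<Longrightarrow> \<exists>e \<in> free_edges n h. \<forall>F. Inv (h @ [(e, F)])"
    and final: "\<And>h. \<lbrakk>legal_history n b h; finished n h; Inv h\<rbrakk> \<Longrightarrow> P (maker_edges h)"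
  shows "maker_can_guarantee n b P"
proof -
  \<comment> \<open>A strategy must also answer legal histories that it would never produce; where
    \<open>Inv\<close> fails, any free edge will do.\<close>
  define good where
    "good h e \<longleftrightarrow> e \<in> free_edges n h \<and> (Inv h \<longrightarrow> (\<forall>F. Inv (h @ [(e, F)])))" for h e
  define \<sigma> where "\<sigma> h = (SOME e. good h e)" for h
  have good: "good h (\<sigma> h)" if "legal_history n b h" "\<not> finished n h" for h
  proof -
    have "\<exists>e. good h e"
      using step[OF that] that(2) by (cases "Inv h") (auto simp: good_def finished_def)
    then show ?thesis
      unfolding \<sigma>_def by (rule someI_ex)
  qed
  have "Inv h" if "legal_history n b h" "follows \<sigma> h" for h
    using that
  proof induction
    case start
    show ?case by (rule init)
  next
    case (round h e F)
    have e: "e = \<sigma> h" and "follows \<sigma> h"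
      using round.prems by (simp_all add: follows_snoc)
    then have "Inv h"
      by (intro round.IH)
    moreover have "good h e"
      unfolding e using good round.hyps by (auto simp: finished_def)
    ultimately show ?case
      by (simp add: good_def)
  qed
  then show ?thesis
    unfolding maker_can_guarantee_def maker_strategy_def
    using good final by (auto simp: good_def intro!: exI[of _ \<sigma>])
qed

section \<open>Depth-first search\<close>

text \<open>\<open>S\<close> is the set of finished vertices and \<open>U\<close> the stack, with the current vertex at its head.\<close>
definition dfs_state :: "nat \<Rightarrow> nat \<Rightarrow> history \<Rightarrow> nat set \<Rightarrow> nat list \<Rightarrow> bool" where
  "dfs_state n m h S U \<longleftrightarrow>
     S \<subseteq> {1..n} \<and> set U \<subseteq> {1..n} \<and> S \<inter> set U = {} \<and> distinct U \<and>
     successively (\<lambda>x y. {x, y} \<in> maker_edges h) U \<and>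
     (\<forall>x \<in> S. \<forall>y \<in> {1..n} - S - set U. {x, y} \<in> breaker_edges h) \<and>
     (\<forall>e \<in> maker_edges h. e \<subseteq> S \<union> set U) \<and>
     length h \<le> card S + length U \<and> card S + length U \<le> m"

lemma card_visited:
  assumes "dfs_state n m h S U"
  shows "card (S \<union> set U) = card S + length U"
proof -
  have "finite S"
    using assms by (auto simp: dfs_state_def intro: finite_subset)
  then show ?thesis
    using assms by (auto simp: dfs_state_def card_Un_disjoint distinct_card)
qed

lemma card_unvisited:
  assumes "dfs_state n m h S U"
  shows "card ({1..n} - S - set U) = n - (card S + length U)"
proof -
  have "S \<union> set U \<subseteq> {1..n}"
    using assms by (auto simp: dfs_state_def)
  then have "card ({1..n} - (S \<union> set U)) = n - card (S \<union> set U)"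
    by (subst card_Diff_subset) (auto intro: finite_subset)
  then show ?thesis
    using card_visited[OF assms] by (simp add: Diff_eq Int_assoc)
qed

text \<open>A new root adds a visited vertex without costing a round, so rounds only stay below the
  number of visited vertices.\<close>

lemma dfs_state_push:
  assumes "dfs_state n m h S []" "card S < m" "w \<in> {1..n} - S"
  shows "dfs_state n m h S [w]"
  using assms by (auto simp: dfs_state_def)

lemma dfs_state_pop:
  assumes "dfs_state n m h S (u # U)"
    and "\<forall>w \<in> {1..n} - S - set (u # U). {u, w} \<in> breaker_edges h"
  shows "dfs_state n m h (insert u S) U"
proof -
  have "finite S" "u \<notin> S"
    using assms by (auto simp: dfs_state_def intro: finite_subset)
  then show ?thesis
    using assms by (auto simp: dfs_state_def successively_Cons)
qed

text \<open>One round pays for one new visited vertex. The reply \<open>F\<close> is arbitrary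
  because Breaker's edges only grow and the unvisited set only shrinks.\<close>

lemma dfs_state_extend:
  assumes "dfs_state n m h S (u # U)" "card S + length (u # U) < m"
    and "w \<in> {1..n} - S - set (u # U)"
  shows "dfs_state n m (h @ [({u, w}, F)]) S (w # u # U)"
  using assms by (auto simp: dfs_state_def insert_commute elim: successively_mono)

text \<open>Pushing a root and popping happen between rounds, with \<open>h\<close> unchanged. Each
  raises \<open>2 * card S + length U\<close> by one, and this is at most \<open>2 * m\<close>, so
  the search reaches \<open>m\<close> visited vertices or a free edge from the current
  vertex.\<close>

lemma dfs_progress:
  assumes "dfs_state n m h S U" "m \<le> n"
  shows "(\<exists>S U. dfs_state n m h S U \<and> card S + length U = m) \<or>
    (\<exists>e \<in> free_edges n h. \<forall>F. \<exists>S U. dfs_state n m (h @ [(e, F)]) S U)"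
  using assms(1)
proof (induction "2 * m - (2 * card S + length U)" arbitrary: S U rule: less_induct)
  case less
  note st = less.prems
  have finS: "finite S"
    using st by (auto simp: dfs_state_def intro: finite_subset)
  have le: "card S + length U \<le> m"
    using st by (auto simp: dfs_state_def)
  show ?case
  proof (cases "card S + length U = m")
    case True
    then show ?thesis using st by blast
  next
    case False
    with le have lt: "card S + length U < m" by simp
    have "{1..n} - S - set U \<noteq> {}"
      using card_unvisited[OF st] lt assms(2) by (metis card.empty leD order.strict_trans2 diff_is_0_eq)
    then obtain w where w: "w \<in> {1..n} - S - set U" by blast
    show ?thesis
    proof (cases U)
      case Nil
      have "dfs_state n m h S [w]"
        using dfs_state_push st w lt Nil by simp
      then show ?thesis
        using less.hyps[of S "[w]"] lt Nil by simp
    next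
      case (Cons u U')
      show ?thesis
      proof (cases "\<forall>w \<in> {1..n} - S - set (u # U'). {u, w} \<in> breaker_edges h")
        case True
        have "u \<notin> S"
          using st Cons by (auto simp: dfs_state_def)
        \<comment> \<open>By \<open>lt\<close> the old difference is positive, so truncated
          subtraction does decrease.\<close>
        then have "2 * m - (2 * card (insert u S) + length U') < 2 * m - (2 * card S + length U)"
          using finS lt Cons by simp
        then show ?thesis
          using less.hyps dfs_state_pop[OF _ True] st Cons by blast
      next
        case False
        then obtain w where w: "w \<in> {1..n} - S - set (u # U')" "{u, w} \<notin> breaker_edges h"
          by blast
        \<comment> \<open>Maker's edges join visited vertices only, and \<open>w\<close> is
          unvisited.\<close>
        have "{u, w} \<in> free_edges n h"
          using st w Cons by (auto simp: dfs_state_def free_edges_def complete_edges_def)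
        then show ?thesis
          using dfs_state_extend[OF _ _ w(1)] st lt Cons by blast
      qed
    qed
  qed
qed

section \<open>Counting Breaker's edges and bounding the stack\<close>

lemma card_finished_bound:
  assumes "legal_history n b h" "dfs_state n m h S U" "card S + length U = m"
  shows "card S * (n - m) \<le> b * m"
proof -
  let ?T = "{1..n} - S - set U"
  let ?f = "\<lambda>(x, y). {x, y :: nat}"
  have fin: "finite (breaker_edges h)" and le: "card (breaker_edges h) \<le> b * length h"
    using breaker_edges_card[OF assms(1)] by auto
  \<comment> \<open>\<open>S\<close> and \<open>?T\<close> are disjoint, so an unordered pair
    determines its ordered version.\<close>
  have "inj_on ?f (S \<times> ?T)"
    by (auto simp: inj_on_def doubleton_eq_iff)
  then have "card S * card ?T = card (?f ` (S \<times> ?T))"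
    by (simp add: card_image card_cartesian_product)
  also have "\<dots> \<le> card (breaker_edges h)"
    using assms(2) by (intro card_mono fin) (auto simp: dfs_state_def)
  also have "\<dots> \<le> b * m"
    using le assms(2,3) by (auto simp: dfs_state_def intro: order_trans)
  finally show ?thesis
    using card_unvisited[OF assms(2)] assms(3) by simp
qed

text \<open>Separates the game from the arithmetic, which enters only through \<open>long\<close>.
  Once \<open>m\<close> vertices are visited the stack is a long enough path, and it survives all
  later moves.\<close>

lemma maker_guarantees_path:
  assumes "m \<le> n" and long: "\<And>s u. \<lbrakk>s + u = m; s * (n - m) \<le> b * m\<rbrakk> \<Longrightarrow> l < u"
  shows "maker_can_guarantee n b (\<lambda>E. \<exists>p. is_path {1..n} E p \<and> l \<le> path_length p)"
proof -
  define P where "P E \<longleftrightarrow> (\<exists>p. is_path {1..n} E p \<and> l \<le> path_length p)" for E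
  define Inv where "Inv h \<longleftrightarrow> P (maker_edges h) \<or> (\<exists>S U. dfs_state n m h S U)" for h
  have P_mono: "P (insert e E)" if "P E" for e E
    using that by (auto simp: P_def is_path_def)
  have progress: "P (maker_edges h) \<or>
      (\<exists>e \<in> free_edges n h. \<forall>F. \<exists>S U. dfs_state n m (h @ [(e, F)]) S U)"
    if h: "legal_history n b h" "Inv h" for h
  proof -
    have "P (maker_edges h)" if st: "dfs_state n m h S U" "card S + length U = m" for S U
    proof -
      have "l < length U"
        using long[OF st(2) card_finished_bound[OF h(1) st]] .
      then show ?thesis
        using st(1) unfolding P_def
        by (intro exI[of _ U])
          (auto simp: dfs_state_def is_path_def path_length_def successively_conv_nth)
    qed
    then show ?thesis
      using h(2) dfs_progress[OF _ assms(1)] unfolding Inv_def by blast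
  qed
  have "maker_can_guarantee n b P"
  proof (rule maker_can_guarantee_by_invariant[of Inv])
    have "dfs_state n m [] {} []"
      by (simp add: dfs_state_def)
    then show "Inv []"
      by (auto simp: Inv_def)
  next
    fix h assume h: "legal_history n b h" "\<not> finished n h" "Inv h"
    show "\<exists>e \<in> free_edges n h. \<forall>F. Inv (h @ [(e, F)])"
    proof (cases "P (maker_edges h)")
      case True
      then show ?thesis
        using h(2) P_mono by (auto simp: Inv_def finished_def)
    next
      case False
      then show ?thesis
        using progress[OF h(1,3)] unfolding Inv_def by blast
    qed
  next
    \<comment> \<open>With no free edge left, \<open>progress\<close> leaves only the path.\<close>
    fix h assume "legal_history n b h" "finished n h" "Inv h"
    then show "P (maker_edges h)"
      using progress by (auto simp: finished_def)
  qed
  then show ?thesis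
    unfolding P_def .
qed

text \<open>Substituting \<open>s = m - u\<close> gives
  \<open>m * (\<epsilon> * n - m - 1) \<le> u * n\<close>, whose left side is at least
  \<open>(\<epsilon> * n / 4)\<^sup>2\<close>. The summand 1 absorbs rounding up the length and the
  offset between vertices and edges.\<close>

lemma stack_size_bound:
  fixes \<epsilon> :: real and n m b s u :: nat
  assumes \<epsilon>: "0 < \<epsilon>" "\<epsilon> < 1" and n: "32 / \<epsilon>\<^sup>2 \<le> real n"
    and b: "real b \<le> (1 - \<epsilon>) * real n + 1"
    and m: "m = nat \<lfloor>\<epsilon> * real n / 2\<rfloor>"
    and su: "s + u = m" "s * (n - m) \<le> b * m"
  shows "\<epsilon>\<^sup>2 * real n / 32 + 1 \<le> real u"
proof (rule ccontr)
  assume "\<not> ?thesis"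
  then have u: "real u < \<epsilon>\<^sup>2 * real n / 32 + 1" by simp
  have n2: "32 \<le> \<epsilon>\<^sup>2 * real n"
    using n \<epsilon> by (simp add: field_simps)
  have n_pos: "0 < real n"
    using n2 \<epsilon> by (cases "n = 0") auto
  have "\<epsilon>\<^sup>2 * real n \<le> \<epsilon> * real n"
    using \<epsilon> by (intro mult_right_mono) (auto simp: power2_eq_square)
  with n2 have n1: "32 \<le> \<epsilon> * real n" by linarith
  have m_le: "real m \<le> \<epsilon> * real n / 2" and m_ge: "\<epsilon> * real n / 4 \<le> real m"
    unfolding m using n1 by linarith+
  have "\<epsilon> * real n \<le> 1 * real n"
    using \<epsilon> by (intro mult_right_mono) auto
  then have mn: "m \<le> n"
    using m_le by linarith
  have "real (s * (n - m)) \<le> real (b * m)"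
    using su(2) by (simp only: of_nat_le_iff)
  moreover have "real s = real m - real u"
    using su(1) by simp
  ultimately have "(real m - real u) * (real n - real m) \<le> real b * real m"
    using mn by (simp add: of_nat_diff)
  also have "\<dots> \<le> ((1 - \<epsilon>) * real n + 1) * real m"
    using b by (intro mult_right_mono) auto
  finally have "real m * (\<epsilon> * real n - real m - 1) \<le> real u * (real n - real m)"
    by (simp add: algebra_simps)
  also have "\<dots> \<le> real u * real n"
    by (intro mult_left_mono) auto
  also have "\<dots> < (\<epsilon>\<^sup>2 * real n / 32 + 1) * real n"
    using u n_pos by (intro mult_strict_right_mono)
  \<comment> \<open>The lower bound on \<open>n\<close> makes 1 at most
    \<open>\<epsilon>\<^sup>2 * real n / 32\<close>; this halves the constant 1/16.\<close>
  also have "\<dots> \<le> (\<epsilon>\<^sup>2 * real n / 16) * real n"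
    using n2 by (intro mult_right_mono; linarith)
  also have "\<dots> = (\<epsilon> * real n / 4) * (\<epsilon> * real n / 4)"
    by (simp add: power2_eq_square)
  \<comment> \<open>The second factor is at least \<open>\<epsilon> * real n / 2 - 1\<close>, and
    \<open>n1\<close> makes this at least \<open>\<epsilon> * real n / 4\<close>.\<close>
  also have "\<dots> \<le> real m * (\<epsilon> * real n - real m - 1)"
    using m_le m_ge n1 by (intro mult_mono) auto
  finally show False by simp
qed

theorem theorem6:
  "\<exists>c::real. c > 0 \<and> (\<exists>\<epsilon>\<^sub>0::real. \<epsilon>\<^sub>0 > 0 \<and>
     (\<forall>\<epsilon>::real. 0 < \<epsilon> \<and> \<epsilon> < \<epsilon>\<^sub>0 \<longrightarrow>
       (\<exists>N::nat. \<forall>n\<ge>N. \<forall>b::nat.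
          int b = \<lfloor>(1 - \<epsilon>) * real n\<rfloor> \<or> int b = \<lceil>(1 - \<epsilon>) * real n\<rceil> \<longrightarrow>
          maker_can_guarantee n b
            (\<lambda>E. \<exists>p. is_path {1..n} E p \<and> real (path_length p) \<ge> c * \<epsilon>\<^sup>2 * real n))))"
proof -
  have main: "maker_can_guarantee n b
      (\<lambda>E. \<exists>p. is_path {1..n} E p \<and> real (path_length p) \<ge> 1 / 32 * \<epsilon>\<^sup>2 * real n)"
    if \<epsilon>: "0 < \<epsilon>" "\<epsilon> < 1" and n: "nat \<lceil>32 / \<epsilon>\<^sup>2\<rceil> \<le> n"
      and b: "int b = \<lfloor>(1 - \<epsilon>) * real n\<rfloor> \<or> int b = \<lceil>(1 - \<epsilon>) * real n\<rceil>"
    for \<epsilon> :: real and n b :: nat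
  proof -
    define m where "m = nat \<lfloor>\<epsilon> * real n / 2\<rfloor>"
    define l where "l = nat \<lceil>\<epsilon>\<^sup>2 * real n / 32\<rceil>"
    have "\<epsilon> * real n \<le> 1 * real n"
      using \<epsilon> by (intro mult_right_mono) auto
    then have mn: "m \<le> n"
      unfolding m_def by linarith
    have n': "32 / \<epsilon>\<^sup>2 \<le> real n"
      using n by linarith
    \<comment> \<open>The summand 1 covers both roundings of the bias.\<close>
    have b': "real b \<le> (1 - \<epsilon>) * real n + 1"
      using b by linarith
    have "0 \<le> \<epsilon>\<^sup>2 * real n"
      by simp
    then have "l < u" if "s + u = m" "s * (n - m) \<le> b * m" for s u
      using stack_size_bound[OF \<epsilon> n' b' m_def that] unfolding l_def by linarith
    then have "maker_can_guarantee n b (\<lambda>E. \<exists>p. is_path {1..n} E p \<and> l \<le> path_length p)"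
      by (rule maker_guarantees_path[OF mn])
    moreover have "(l \<le> k) = (1 / 32 * \<epsilon>\<^sup>2 * real n \<le> real k)" for k
      unfolding l_def by (simp add: nat_le_iff ceiling_le_iff)
    ultimately show ?thesis
      by simp
  qed
  show ?thesis
    by (intro exI[of _ "1 / 32 :: real"] conjI exI[of _ "1 :: real"] allI impI
        exI[of _ "nat \<lceil>32 / \<epsilon>\<^sup>2\<rceil>" for \<epsilon> :: real] main) auto
qed

end
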